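(* Let $p,q\ge4$ be even integers, $c\in[0,1]$, and consider the spherical $(p+q)$-spin model with $h=0$, i.e. $\xi(s)=cs^p+(1-c)s^q$. If $$2pq+4\ge3(p+q)+(p-q)^2,$$ then both of the following hold: $\xi'(1)>\xi''(0)(1+z)$, and $s\mapsto s/\xi'(s)$ is convex on $(0,1)$.
   Context: Here $z\ge0$ is the unique solution of $$\frac1{\xi'(1)}=\frac{1+z}{z^2}\log(1+z)-\frac1z,$$ where the right-hand side is strictly decreasing in $z$, from $1/2$ (its limit at $z=0$) to $0$ as $z\to\infty$. ($h$ denotes the external field strength of the model; it does not enter the conclusion.) *)

theory Defs
  imports "HOL-Analysis.Analysis" "HOL-Real_Asymp.Real_Asymp"
begin

definition mixture :: "nat \<Rightarrow> nat \<Rightarrow> real \<Rightarrow> real \<Rightarrow> real" where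
  "mixture p q c s = c * s ^ p + (1 - c) * s ^ q"

(* The value at 0 is the limit of the formula as z tends to 0 from the right. *)
definition z_rhs :: "real \<Rightarrow> real" where
  "z_rhs z = (if z = 0 then 1 / 2 else (1 + z) / z\<^sup>2 * ln (1 + z) - 1 / z)"

(* A unique such z exists whenever deriv \<xi> 1 is at least 2; see zpar_ex1 below. *)
definition zpar :: "(real \<Rightarrow> real) \<Rightarrow> real" where
  "zpar \<xi> = (THE z. 0 \<le> z \<and> 1 / deriv \<xi> 1 = z_rhs z)"

lemma ln_one_plus_gt:
  fixes z :: real
  assumes "0 < z"
  shows "2 * z / (2 + z) < ln (1 + z)"
proof -
  let ?f = "\<lambda>t::real. ln (1 + t) - 2 * t / (2 + t)"
  have "?f 0 < ?f z"
  proof (rule DERIV_pos_imp_increasing_open[OF assms])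
    fix t :: real assume t: "0 < t" "t < z"
    have "(?f has_real_derivative (1 / (1 + t) - 4 / (2 + t)\<^sup>2)) (at t)"
      using t by (auto intro!: derivative_eq_intros simp: power2_eq_square field_simps)
    moreover have "1 / (1 + t) - 4 / (2 + t)\<^sup>2 = t\<^sup>2 / ((1 + t) * (2 + t)\<^sup>2)"
      using t by (simp add: divide_simps) (simp add: power2_eq_square algebra_simps)
    moreover have "0 < t\<^sup>2 / ((1 + t) * (2 + t)\<^sup>2)"
      using t by simp
    ultimately show "\<exists>y. DERIV ?f t :> y \<and> 0 < y" by metis
  next
    show "continuous_on {0..z} ?f"
      by (intro continuous_intros) auto
  qed
  then show ?thesis by simp
qed

lemma z_rhs_deriv:
  fixes z :: real
  assumes "0 < z"
  shows "(z_rhs has_real_derivative (2 * z - (2 + z) * ln (1 + z)) / z ^ 3) (at z)"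
proof -
  have num: "((\<lambda>z. (1 + z) * ln (1 + z) - z) has_real_derivative ln (1 + z)) (at z)"
    using assms by (auto intro!: derivative_eq_intros)
  have den: "((\<lambda>z::real. z\<^sup>2) has_real_derivative 2 * z) (at z)"
    by (auto intro!: derivative_eq_intros)
  have eq: "(ln (1 + z) * z\<^sup>2 - ((1 + z) * ln (1 + z) - z) * (2 * z)) / (z\<^sup>2 * z\<^sup>2) =
      (2 * z - (2 + z) * ln (1 + z)) / z ^ 3"
  proof -
    have "ln (1 + z) * z\<^sup>2 - ((1 + z) * ln (1 + z) - z) * (2 * z) =
        z * (2 * z - (2 + z) * ln (1 + z))"
      by (simp add: power2_eq_square algebra_simps)
    moreover have "z\<^sup>2 * z\<^sup>2 = z * z ^ 3"
      by (simp add: power2_eq_square power3_eq_cube)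
    ultimately show ?thesis using assms by simp
  qed
  have "((\<lambda>z. ((1 + z) * ln (1 + z) - z) / z\<^sup>2) has_real_derivative
          (2 * z - (2 + z) * ln (1 + z)) / z ^ 3) (at z)"
    using DERIV_divide[OF num den] assms eq by simp
  moreover have "((1 + t) * ln (1 + t) - t) / t\<^sup>2 = z_rhs t" if "t \<in> {0<..}" for t
    using that by (simp add: z_rhs_def diff_divide_distrib power2_eq_square)
  ultimately show ?thesis
    using assms by (auto intro: has_field_derivative_transform_within_open[of _ _ _ "{0<..}"])
qed

lemma z_rhs_deriv_neg:
  fixes z :: real
  assumes "0 < z"
  shows "(2 * z - (2 + z) * ln (1 + z)) / z ^ 3 < 0"
  proof -
  have "2 * z < (2 + z) * ln (1 + z)"
    using ln_one_plus_gt[OF assms] assms by (simp add: pos_divide_less_eq mult.commute)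
  then show ?thesis using assms by (simp add: divide_neg_pos)
qed

lemma z_rhs_tendsto_0: "(z_rhs \<longlongrightarrow> 1 / 2) (at_right 0)"
proof -
  have "((\<lambda>z::real. (1 + z) / z\<^sup>2 * ln (1 + z) - 1 / z) \<longlongrightarrow> 1 / 2) (at_right 0)"
    by real_asymp
  moreover have "eventually (\<lambda>z. (1 + z) / z\<^sup>2 * ln (1 + z) - 1 / z = z_rhs z) (at_right 0)"
    using eventually_at_right_less[of "0::real"] by eventually_elim (simp add: z_rhs_def)
  ultimately show ?thesis by (rule Lim_transform_eventually)
qed

lemma z_rhs_tendsto_top: "(z_rhs \<longlongrightarrow> 0) at_top"
proof -
  have "((\<lambda>z::real. (1 + z) / z\<^sup>2 * ln (1 + z) - 1 / z) \<longlongrightarrow> 0) at_top"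
    by real_asymp
  moreover have "eventually (\<lambda>z. (1 + z) / z\<^sup>2 * ln (1 + z) - 1 / z = z_rhs z) at_top"
    using eventually_gt_at_top[of "0::real"] by eventually_elim (simp add: z_rhs_def)
  ultimately show ?thesis by (rule Lim_transform_eventually)
qed

lemma z_rhs_continuous: "continuous_on {0..z} z_rhs"
  unfolding continuous_on_eq_continuous_within
proof
  fix t :: real assume t: "t \<in> {0..z}"
  show "continuous (at t within {0..z}) z_rhs"
  proof (cases "t = 0")
    case True
    have "(z_rhs \<longlongrightarrow> 1 / 2) (at 0 within {0..z})"
    proof (rule tendsto_mono[OF _ z_rhs_tendsto_0])
      have "at 0 within {0..z} = at 0 within ({0..z} - {0})"
        by (simp add: at_within_def)
      also have "\<dots> \<le> at_right 0" by (rule at_le) auto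
      finally show "at 0 within {0..z} \<le> at_right 0" .
    qed
    then show ?thesis using True by (simp add: continuous_within z_rhs_def)
  next
    case False
    then show ?thesis
      using t z_rhs_deriv[of t] by (auto intro: DERIV_isCont continuous_at_imp_continuous_at_within)
  qed
qed

lemma z_rhs_strict_antimono:
  assumes "0 \<le> a" "a < b"
  shows "z_rhs b < z_rhs a"
proof -
  have "- z_rhs a < - z_rhs b"
  proof (rule DERIV_pos_imp_increasing_open[OF assms(2)])
    fix t assume "a < t" "t < b"
    then have "0 < t" using assms by simp
    from DERIV_minus[OF z_rhs_deriv[OF this]] z_rhs_deriv_neg[OF this]
    show "\<exists>y. DERIV (\<lambda>x. - z_rhs x) t :> y \<and> 0 < y"
      by (intro exI conjI) (assumption, simp only: neg_0_less_iff_less)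
  next
    show "continuous_on {a..b} (\<lambda>x. - z_rhs x)"
      by (rule continuous_on_minus, rule continuous_on_subset[OF z_rhs_continuous[of b]])
         (use assms in auto)
  qed
  then show ?thesis by simp
qed

lemma z_rhs_ex1:
  assumes "0 < x" "x \<le> 1 / 2"
  shows "\<exists>!z. 0 \<le> z \<and> x = z_rhs z"
proof -
  have "eventually (\<lambda>z. z_rhs z < x \<and> 0 \<le> z) at_top"
    using order_tendstoD(2)[OF z_rhs_tendsto_top assms(1)] eventually_ge_at_top[of 0]
    by eventually_elim simp
  then obtain b where b: "z_rhs b < x" "0 \<le> b"
    using eventually_happens'[OF trivial_limit_at_top_linorder] by blast
  have "x \<le> z_rhs 0" using assms(2) by (simp add: z_rhs_def)
  with b obtain z where z: "0 \<le> z" "z_rhs z = x"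
    using IVT2'[OF less_imp_le[OF b(1)] _ b(2) z_rhs_continuous] by blast
  show ?thesis
  proof (rule ex1I[of _ z])
    show "0 \<le> z \<and> x = z_rhs z" using z by simp
  next
    fix y assume y: "0 \<le> y \<and> x = z_rhs y"
    show "y = z"
    proof (cases y z rule: linorder_cases)
      case less
      then show ?thesis using z_rhs_strict_antimono[of y z] y z by simp
    next
      case greater
      then show ?thesis using z_rhs_strict_antimono[of z y] y z by simp
    qed
  qed
qed

lemma zpar_ex1:
  assumes "2 \<le> deriv \<xi> 1"
  shows "\<exists>!z. 0 \<le> z \<and> 1 / deriv \<xi> 1 = z_rhs z"
  by (rule z_rhs_ex1) (use assms in \<open>auto simp: field_simps\<close>)

lemma deriv_mixture:
  "deriv (mixture p q c) s = c * real p * s ^ (p - 1) + (1 - c) * real q * s ^ (q - 1)"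
  by (rule DERIV_imp_deriv) (auto simp: mixture_def[abs_def] intro!: derivative_eq_intros)

lemma zpar_mixture:
  assumes "2 \<le> p" "2 \<le> q" "0 \<le> c" "c \<le> 1"
  shows "0 \<le> zpar (mixture p q c)"
    and "1 / deriv (mixture p q c) 1 = z_rhs (zpar (mixture p q c))"
proof -
  have "2 = c * 2 + (1 - c) * 2" by simp
  also have "\<dots> \<le> c * real p + (1 - c) * real q"
    using assms by (intro add_mono mult_left_mono) auto
  finally have "2 \<le> deriv (mixture p q c) 1" by (simp add: deriv_mixture)
  from theI'[OF zpar_ex1[OF this]]
  show "0 \<le> zpar (mixture p q c)"
    and "1 / deriv (mixture p q c) 1 = z_rhs (zpar (mixture p q c))"
    by (simp_all add: zpar_def)
qed

end

theory Submission
  imports Defs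
begin

text \<open>Since \<open>p, q \<ge> 4\<close>, every term of \<open>\<xi>''(s)\<close> carries a positive power of \<open>s\<close>, so
  \<open>\<xi>''(0) = 0\<close>. The first claim therefore reduces to \<open>\<xi>'(1) > 0\<close>.

  For the second claim, on \<open>(0,1)\<close> the function \<open>s / \<xi>'(s)\<close> is the reciprocal of
  \<open>g(s) = A + B\<close>, where \<open>A = c p s\<^sup>m\<close>, \<open>B = (1 - c) q s\<^sup>n\<close>, \<open>m = p - 2\<close> and \<open>n = q - 2\<close>.
  As \<open>(1 / g)'' = (2 g'\<^sup>2 - g g'') / g\<^sup>3\<close>, a positive function has a convex reciprocal when
  \<open>g g'' \<le> 2 g'\<^sup>2\<close> (\<open>convex_on_inverse_if\<close>). Multiplied by \<open>s\<^sup>2\<close>, the difference of the two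
  sides is a quadratic form in \<open>A, B \<ge> 0\<close>, namely
  \<open>m (m + 1) A\<^sup>2 + n (n + 1) B\<^sup>2 + (2 m n + m + n - (m - n)\<^sup>2) A B\<close>.
  Its square terms are nonnegative, and in terms of \<open>p\<close> and \<open>q\<close> its mixed coefficient is
  \<open>2 p q + 4 - 3 (p + q) - (p - q)\<^sup>2\<close>; so the hypothesis says exactly that the mixed coefficient
  is nonnegative (\<open>convex_on_inverse_binomial\<close>).\<close>

lemma convex_on_inverse_if:
  fixes g g' g'' :: "real \<Rightarrow> real"
  assumes "convex C"
    and g: "\<And>s. s \<in> C \<Longrightarrow> (g has_real_derivative g' s) (at s)"
    and g': "\<And>s. s \<in> C \<Longrightarrow> (g' has_real_derivative g'' s) (at s)"
    and pos: "\<And>s. s \<in> C \<Longrightarrow> 0 < g s"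
    and le: "\<And>s. s \<in> C \<Longrightarrow> g s * g'' s \<le> 2 * (g' s)\<^sup>2"
  shows "convex_on C (\<lambda>s. 1 / g s)"
proof (rule f''_ge0_imp_convex[OF \<open>convex C\<close>])
  fix s assume s: "s \<in> C"
  note nz = pos[OF s, THEN less_imp_neq, THEN not_sym]
  show "((\<lambda>s. 1 / g s) has_real_derivative - g' s / (g s)\<^sup>2) (at s)"
    using nz by (auto intro!: derivative_eq_intros g[OF s] simp: power2_eq_square)
  show "((\<lambda>s. - g' s / (g s)\<^sup>2) has_real_derivative
      (2 * (g' s)\<^sup>2 - g s * g'' s) / g s ^ 3) (at s)"
    using nz
    by (auto intro!: derivative_eq_intros g[OF s] g'[OF s]
        simp: field_simps power2_eq_square power3_eq_cube)
  show "0 \<le> (2 * (g' s)\<^sup>2 - g s * g'' s) / g s ^ 3"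
    using pos[OF s] le[OF s] by simp
qed

lemma convex_on_eq_on:
  assumes "convex_on C f" "\<And>s. s \<in> C \<Longrightarrow> f s = g s"
  shows "convex_on C g"
  using assms unfolding convex_on_def by (metis convexD)

text \<open>Writing the derivative with \<open>s ^ m / s\<close> instead of \<open>s ^ (m - 1)\<close> makes \<open>g\<close>, \<open>s g'\<close> and
  \<open>s\<^sup>2 g''\<close> linear combinations of the same monomials \<open>A\<close> and \<open>B\<close>, and avoids truncated
  subtraction in exponents.\<close>

lemma has_real_derivative_power_at_pos:
  fixes s :: real
  assumes "0 < s"
  shows "((\<lambda>s. s ^ m) has_real_derivative real m * s ^ m / s) (at s)"
  by (rule DERIV_cong[OF DERIV_pow]) (use assms in \<open>cases m; simp\<close>)

text \<open>The condition on \<open>m\<close> and \<open>n\<close> says that the mixed coefficient of the quadratic form in \<open>A\<close>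
  and \<open>B\<close> is nonnegative; the coefficients of \<open>A\<^sup>2\<close> and \<open>B\<^sup>2\<close> always are.\<close>

lemma convex_on_inverse_binomial:
  fixes a b :: real and m n :: nat
  assumes "0 \<le> a" "0 \<le> b" "0 < a + b"
    and mixed: "(real m - real n)\<^sup>2 \<le> 2 * real m * real n + real m + real n"
  shows "convex_on {0<..} (\<lambda>s. 1 / (a * s ^ m + b * s ^ n))"
proof (rule convex_on_inverse_if)
  fix s :: real assume "s \<in> {0<..}"
  then have s: "0 < s" by simp
  define A where "A = a * s ^ m"
  define B where "B = b * s ^ n"
  have nonneg: "0 \<le> A" "0 \<le> B" using assms s by (simp_all add: A_def B_def)
  have "0 < A \<or> 0 < B" using assms s unfolding A_def B_def by (auto simp: zero_less_mult_iff)
  then show "0 < a * s ^ m + b * s ^ n"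
    using nonneg unfolding A_def B_def by linarith
  show "((\<lambda>s. a * s ^ m + b * s ^ n) has_real_derivative
      (a * real m * s ^ m + b * real n * s ^ n) / s) (at s)"
    by (rule derivative_eq_intros has_real_derivative_power_at_pos s refl)+
       (use s in \<open>auto simp: field_simps\<close>)
  show "((\<lambda>s. (a * real m * s ^ m + b * real n * s ^ n) / s) has_real_derivative
      (a * (real m * (real m - 1)) * s ^ m + b * (real n * (real n - 1)) * s ^ n) / s\<^sup>2) (at s)"
    by (rule derivative_eq_intros has_real_derivative_power_at_pos s refl)+
       (use s in \<open>auto simp: field_simps power2_eq_square\<close>)
  have "2 * (real m * A + real n * B)\<^sup>2
      - (A + B) * (real m * (real m - 1) * A + real n * (real n - 1) * B)
    = real m * (real m + 1) * A\<^sup>2 + real n * (real n + 1) * B\<^sup>2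
      + (2 * real m * real n + real m + real n - (real m - real n)\<^sup>2) * (A * B)"
    by (simp add: power2_eq_square algebra_simps)
  also have "0 \<le> \<dots>"
    using nonneg mixed by simp
  finally have "(A + B) * (real m * (real m - 1) * A + real n * (real n - 1) * B) / s\<^sup>2
      \<le> 2 * (real m * A + real n * B)\<^sup>2 / s\<^sup>2"
    by (intro divide_right_mono) simp_all
  then show "(a * s ^ m + b * s ^ n) *
      ((a * (real m * (real m - 1)) * s ^ m + b * (real n * (real n - 1)) * s ^ n) / s\<^sup>2)
    \<le> 2 * ((a * real m * s ^ m + b * real n * s ^ n) / s)\<^sup>2"
    by (simp add: A_def B_def power_divide mult_ac)
qed simp

lemma deriv2_mixture_0:
  assumes "3 \<le> p" "3 \<le> q"
  shows "(deriv ^^ 2) (mixture p q c) 0 = 0"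
proof -
  have "((\<lambda>s. c * real p * s ^ (p - 1) + (1 - c) * real q * s ^ (q - 1))
      has_real_derivative 0) (at 0)"
    using assms by (auto intro!: derivative_eq_intros simp: power_0_left)
  then show ?thesis
    by (simp add: numeral_2_eq_2 deriv_mixture[abs_def] DERIV_imp_deriv)
qed

theorem corollary1:
  fixes p q :: nat and c :: real
  assumes "p \<ge> 4" "q \<ge> 4" "even p" "even q"
    and "c \<in> {0..1}"
    and "2 * int p * int q + 4 \<ge> 3 * (int p + int q) + (int p - int q)\<^sup>2"
  shows "deriv (mixture p q c) 1 >
           (deriv ^^ 2) (mixture p q c) 0 * (1 + zpar (mixture p q c)) \<and>
         convex_on {0<..<1} (\<lambda>s. s / deriv (mixture p q c) s)"
proof -
  define a where "a = c * real p"
  define b where "b = (1 - c) * real q"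
  define m where "m = p - 2"
  define n where "n = q - 2"
  have p: "p = m + 2" and q: "q = n + 2" using assms by (simp_all add: m_def n_def)
  have nonneg: "0 \<le> a" "0 \<le> b" using assms by (simp_all add: a_def b_def)
  have "0 < a \<or> 0 < b"
    using assms by (cases "c = 0") (auto simp: a_def b_def)
  with nonneg have pos: "0 < a + b" by linarith
  have "(int m - int n)\<^sup>2 \<le> 2 * int m * int n + int m + int n"
    using assms(6) by (simp add: p q power2_eq_square algebra_simps)
  then have "real_of_int ((int m - int n)\<^sup>2) \<le> real_of_int (2 * int m * int n + int m + int n)"
    by (simp only: of_int_le_iff)
  then have "(real m - real n)\<^sup>2 \<le> 2 * real m * real n + real m + real n"
    by simp
  with nonneg pos have "convex_on {0<..} (\<lambda>s. 1 / (a * s ^ m + b * s ^ n))"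
    by (intro convex_on_inverse_binomial)
  then have "convex_on {0<..<1} (\<lambda>s. 1 / (a * s ^ m + b * s ^ n))"
    by (rule convex_on_subset) auto
  moreover have "1 / (a * s ^ m + b * s ^ n) = s / deriv (mixture p q c) s"
    if "s \<in> {0<..<1}" for s
  proof -
    have "deriv (mixture p q c) s = s * (a * s ^ m + b * s ^ n)"
      by (simp add: deriv_mixture a_def b_def p q algebra_simps)
    then show ?thesis using that by simp
  qed
  ultimately have "convex_on {0<..<1} (\<lambda>s. s / deriv (mixture p q c) s)"
    by (rule convex_on_eq_on)
  moreover have "deriv (mixture p q c) 1 > 0"
    using pos by (simp add: deriv_mixture a_def b_def)
  ultimately show ?thesis
    using assms by (simp add: deriv2_mixture_0)
qed

end
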